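(* For any $a\in\bigcup_{1\le j\le\ell}S^{\ell-j}$, the function $s\mapsto\psi_s(a)$ is convex on $\mathbb{R}$. The pressure function $s\mapsto P_\varphi(s)$ is also convex on $\mathbb{R}$.
   Context: Let $m\ge2$, $\ell\ge2$, $q\ge2$ be integers, $S=\{0,1,\dots,m-1\}$, and $\varphi:S^\ell\to\mathbb{R}$ a function. For $s\in\mathbb{R}$, $\psi_s:S^{\ell-1}\to(0,\infty)$ is the unique strictly positive function satisfying $$\psi_s(a_1,\dots,a_{\ell-1})^q=\sum_{j\in S}e^{s\varphi(a_1,\dots,a_{\ell-1},j)}\,\psi_s(a_2,\dots,a_{\ell-1},j)\qquad\text{for all }(a_1,\dots,a_{\ell-1})\in S^{\ell-1}.$$ It is extended to $S^k$ for $0\le k\le\ell-2$, downwards in $k$, by $\psi_s(a)=\big(\sum_{j\in S}\psi_s(a,j)\big)^{1/q}$ for $a\in S^k$; here $S^0=\{\emptyset\}$, so $\psi_s(\emptyset)=\big(\sum_{j\in S}\psi_s(j)\big)^{1/q}$. The pressure function is $$P_\varphi(s)=(q-1)q^{\ell-2}\log\sum_{j\in S}\psi_s(j).$$ *)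

theory Defs
  imports "HOL-Analysis.Analysis"
begin

text \<open>The set \<open>S\<^sup>k\<close> for \<open>S = {0, \<dots>, m - 1}\<close>: words of length \<open>k\<close> over \<open>S\<close> are lists.\<close>

definition words :: "nat \<Rightarrow> nat \<Rightarrow> nat list set" where
  "words m k = {a. length a = k \<and> set a \<subseteq> {..<m}}"

text \<open>
  Strictly positive solutions on \<open>S\<^sup>l\<^sup>-\<^sup>1\<close> of the equation defining \<open>\<psi>\<^sub>s\<close>. The extensional function
  space fixes the irrelevant values outside \<open>S\<^sup>l\<^sup>-\<^sup>1\<close>, so that the solution is unique as a HOL function.
\<close>

definition is_psi_base ::
  "nat \<Rightarrow> nat \<Rightarrow> nat \<Rightarrow> (nat list \<Rightarrow> real) \<Rightarrow> real \<Rightarrow> (nat list \<Rightarrow> real) \<Rightarrow> bool" where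
  "is_psi_base m l q \<phi> s f \<longleftrightarrow>
     f \<in> words m (l - 1) \<rightarrow>\<^sub>E {0<..} \<and>
     (\<forall>a\<in>words m (l - 1). f a ^ q = (\<Sum>j<m. exp (s * \<phi> (a @ [j])) * f (tl a @ [j])))"

definition psi_base ::
  "nat \<Rightarrow> nat \<Rightarrow> nat \<Rightarrow> (nat list \<Rightarrow> real) \<Rightarrow> real \<Rightarrow> nat list \<Rightarrow> real" where
  "psi_base m l q \<phi> s = (THE f. is_psi_base m l q \<phi> s f)"

function psi :: "nat \<Rightarrow> nat \<Rightarrow> nat \<Rightarrow> (nat list \<Rightarrow> real) \<Rightarrow> real \<Rightarrow> nat list \<Rightarrow> real" where
  "psi m l q \<phi> s a =
     (if length a < l - 1 then root q (\<Sum>j<m. psi m l q \<phi> s (a @ [j]))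
      else psi_base m l q \<phi> s a)"
  by auto
termination
  by (relation "Wellfounded.measure (\<lambda>(m, l, q, \<phi>, s, a). l - length a)") auto

declare psi.simps [simp del]

definition pressure :: "nat \<Rightarrow> nat \<Rightarrow> nat \<Rightarrow> (nat list \<Rightarrow> real) \<Rightarrow> real \<Rightarrow> real" where
  "pressure m l q \<phi> s =
     (real q - 1) * real q ^ (l - 2) * ln (\<Sum>j<m. psi m l q \<phi> s [j])"

text \<open>Existence and uniqueness of the solution, which make \<^const>\<open>psi_base\<close> well defined.\<close>

lemma finite_words: "finite (words m k)"
proof -
  have "words m k = {xs. set xs \<subseteq> {..<m} \<and> length xs = k}"
    by (auto simp: words_def)
  then show ?thesis by (simp add: finite_lists_length_eq)
qed

lemma words_shift:
  assumes "a \<in> words m (l - 1)" "j < m" "l \<ge> 2"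
  shows "tl a @ [j] \<in> words m (l - 1)"
  using assms by (cases a) (auto simp: words_def)

lemma is_psi_base_le:
  assumes f: "is_psi_base m l q \<phi> s f" and g: "is_psi_base m l q \<phi> s g"
    and "m \<ge> 2" "l \<ge> 2" "q \<ge> 2" and a: "a \<in> words m (l - 1)"
  shows "f a \<le> g a"
proof -
  let ?W = "words m (l - 1)"
  have fp: "f b > 0" and gp: "g b > 0" if "b \<in> ?W" for b
    using that f g by (auto simp: is_psi_base_def PiE_def Pi_def)
  define R where "R = Max ((\<lambda>b. f b / g b) ` ?W)"
  have fin: "finite ((\<lambda>b. f b / g b) ` ?W)" using finite_words by simp
  have R: "f b \<le> R * g b" if "b \<in> ?W" for b
  proof -
    have "f b / g b \<le> R" unfolding R_def using fin that by (intro Max_ge) auto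
    then show ?thesis using gp[OF that] by (simp add: field_simps)
  qed
  have "R \<in> (\<lambda>b. f b / g b) ` ?W" unfolding R_def using fin a by (intro Max_in) auto
  then obtain b where b: "b \<in> ?W" "R = f b / g b" by auto
  have Rp: "R > 0" using b fp gp by simp
  have "f b ^ q = (\<Sum>j<m. exp (s * \<phi> (b @ [j])) * f (tl b @ [j]))"
    using f b by (simp add: is_psi_base_def)
  also have "\<dots> \<le> (\<Sum>j<m. exp (s * \<phi> (b @ [j])) * (R * g (tl b @ [j])))"
    using R words_shift[OF b(1) _ \<open>l \<ge> 2\<close>] by (intro sum_mono mult_left_mono) auto
  also have "\<dots> = R * (\<Sum>j<m. exp (s * \<phi> (b @ [j])) * g (tl b @ [j]))"
    by (simp add: sum_distrib_left mult_ac)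
  also have "\<dots> = R * g b ^ q" using g b by (simp add: is_psi_base_def)
  finally have "R ^ q \<le> R"
    using gp[OF b(1)] by (simp add: b(2) power_divide field_simps)
  have "R \<le> 1"
  proof (rule ccontr)
    assume "\<not> R \<le> 1"
    then have "R ^ 1 < R ^ q" using \<open>q \<ge> 2\<close> by (intro power_strict_increasing) auto
    with \<open>R ^ q \<le> R\<close> show False by simp
  qed
  then have "R * g a \<le> 1 * g a" using gp[OF a] by (intro mult_right_mono) auto
  then show ?thesis using R[OF a] by simp
qed

lemma is_psi_base_exists:
  assumes "m \<ge> 2" "l \<ge> 2" "q \<ge> 2"
  shows "\<exists>f. is_psi_base m l q \<phi> s f"
proof -
  let ?W = "words m (l - 1)"
  define L where "L f a = (\<Sum>j<m. exp (s * \<phi> (a @ [j])) * f (tl a @ [j]))"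
    for f :: "nat list \<Rightarrow> real" and a
  define T where "T f a = root q (L f a)" for f :: "nat list \<Rightarrow> real" and a
  have L_mono: "L f a \<le> L g a" if "a \<in> ?W" "\<And>b. b \<in> ?W \<Longrightarrow> f b \<le> g b" for f g a
    unfolding L_def using that words_shift[OF _ _ \<open>l \<ge> 2\<close>]
    by (intro sum_mono mult_left_mono) auto
  have T_mono: "T f a \<le> T g a" if "a \<in> ?W" "\<And>b. b \<in> ?W \<Longrightarrow> f b \<le> g b" for f g a
    unfolding T_def using L_mono[OF that] \<open>q \<ge> 2\<close> by simp
  define A where "A a = (\<Sum>j<m. exp (s * \<phi> (a @ [j])))" for a
  have L_const: "L (\<lambda>_. c) a = c * A a" for c a
    by (simp add: L_def A_def sum_distrib_left mult_ac)
  have A_pos: "A a > 0" for a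
    unfolding A_def using \<open>m \<ge> 2\<close> by (intro sum_pos) (auto simp: lessThan_empty_iff)
  define C where "C = Max (insert 1 (A ` ?W))"
  define c where "c = Min (insert 1 (A ` ?W))"
  have C: "C \<ge> 1" "\<And>a. a \<in> ?W \<Longrightarrow> A a \<le> C"
    unfolding C_def using finite_words by (auto intro: Max_ge)
  have c: "c \<le> 1" "\<And>a. a \<in> ?W \<Longrightarrow> c \<le> A a"
    unfolding c_def using finite_words by (auto intro: Min_le)
  have "c \<in> insert 1 (A ` ?W)" unfolding c_def using finite_words by (intro Min_in) auto
  then have c0: "c > 0" using A_pos by auto
  have TC: "T (\<lambda>_. C) a \<le> C" if "a \<in> ?W" for a
  proof -
    have "L (\<lambda>_. C) a \<le> C * C" using C(1) C(2)[OF that] by (simp add: L_const mult_left_mono)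
    also have "\<dots> = C ^ 2" by (simp add: power2_eq_square)
    also have "\<dots> \<le> C ^ q" using C(1) \<open>q \<ge> 2\<close> by (intro power_increasing) auto
    finally have "T (\<lambda>_. C) a \<le> root q (C ^ q)" unfolding T_def using \<open>q \<ge> 2\<close> by simp
    then show ?thesis using C(1) \<open>q \<ge> 2\<close> by (simp add: real_root_power_cancel)
  qed
  have Tc: "c \<le> T (\<lambda>_. c) a" if "a \<in> ?W" for a
  proof -
    have "c ^ q \<le> c ^ 2" using c(1) c0 \<open>q \<ge> 2\<close> by (intro power_decreasing) auto
    also have "\<dots> = c * c" by (simp add: power2_eq_square)
    also have "\<dots> \<le> L (\<lambda>_. c) a" using c0 c(2)[OF that] by (simp add: L_const mult_left_mono)
    finally have "root q (c ^ q) \<le> T (\<lambda>_. c) a" unfolding T_def using \<open>q \<ge> 2\<close> by simp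
    then show ?thesis using c0 \<open>q \<ge> 2\<close> by (simp add: real_root_power_cancel)
  qed
  define u where "u n = (T ^^ n) (\<lambda>_. C)" for n
  have u0: "u 0 = (\<lambda>_. C)" and uS: "\<And>n. u (Suc n) = T (u n)" by (simp_all add: u_def)
  have low: "\<And>a. a \<in> ?W \<Longrightarrow> c \<le> u n a" for n
  proof (induction n)
    case 0
    then show ?case using c(1) C(1) by (simp add: u0)
  next
    case (Suc n)
    have "c \<le> T (\<lambda>_. c) a" using Tc Suc.prems .
    also have "\<dots> \<le> T (u n) a" using Suc by (intro T_mono) auto
    finally show ?case by (simp add: uS)
  qed
  have dec: "\<And>a. a \<in> ?W \<Longrightarrow> u (Suc n) a \<le> u n a" for n
  proof (induction n)
    case 0
    then show ?case using TC by (simp add: u0 uS)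
  next
    case (Suc n)
    have "T (u (Suc n)) a \<le> T (u n) a" using Suc by (intro T_mono) auto
    then show ?case by (simp add: uS)
  qed
  have "\<exists>x. (\<lambda>n. u n a) \<longlonglongrightarrow> x" if "a \<in> ?W" for a
    using decseq_convergent[of "\<lambda>n. u n a" c] low[OF that] dec[OF that]
    by (metis decseq_SucI)
  then obtain x where x: "\<And>a. a \<in> ?W \<Longrightarrow> (\<lambda>n. u n a) \<longlonglongrightarrow> x a" by metis
  define f where "f = restrict x ?W"
  have f_lim: "(\<lambda>n. u n a) \<longlonglongrightarrow> f a" if "a \<in> ?W" for a using x[OF that] that by (simp add: f_def)
  have "f a > 0" if "a \<in> ?W" for a
    using LIMSEQ_le_const[OF f_lim[OF that], of c] low[OF that] c0 by force
  then have "f \<in> ?W \<rightarrow>\<^sub>E {0<..}" by (auto simp: f_def)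
  moreover have "f a ^ q = L f a" if a: "a \<in> ?W" for a
  proof (rule LIMSEQ_unique)
    show "(\<lambda>n. u (Suc n) a ^ q) \<longlonglongrightarrow> f a ^ q"
      using LIMSEQ_Suc[OF f_lim[OF a]] by (rule tendsto_power)
    have "L (u n) a \<ge> 0" for n
    proof -
      have "L (\<lambda>_. c) a \<le> L (u n) a" using a low by (intro L_mono) auto
      moreover have "L (\<lambda>_. c) a \<ge> 0" using c0 A_pos[of a] by (simp add: L_const)
      ultimately show ?thesis by simp
    qed
    then have "u (Suc n) a ^ q = L (u n) a" for n
      using \<open>q \<ge> 2\<close> by (simp add: uS T_def)
    moreover have "(\<lambda>n. L (u n) a) \<longlonglongrightarrow> L f a"
      unfolding L_def using f_lim words_shift[OF a _ \<open>l \<ge> 2\<close>] by (intro tendsto_intros) auto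
    ultimately show "(\<lambda>n. u (Suc n) a ^ q) \<longlonglongrightarrow> L f a" by simp
  qed
  ultimately have "is_psi_base m l q \<phi> s f" by (simp add: is_psi_base_def L_def)
  then show ?thesis by blast
qed

lemma is_psi_base_ex1:
  assumes "m \<ge> 2" "l \<ge> 2" "q \<ge> 2"
  shows "\<exists>!f. is_psi_base m l q \<phi> s f"
proof (rule ex_ex1I)
  show "\<exists>f. is_psi_base m l q \<phi> s f" using assms by (rule is_psi_base_exists)
next
  fix f g assume fg: "is_psi_base m l q \<phi> s f" "is_psi_base m l q \<phi> s g"
  then have "f a = g a" if "a \<in> words m (l - 1)" for a
    using is_psi_base_le assms that by (meson order_antisym)
  with fg show "f = g" by (auto simp: is_psi_base_def intro: PiE_ext)
qed

lemma is_psi_base_psi_base: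
  assumes "m \<ge> 2" "l \<ge> 2" "q \<ge> 2"
  shows "is_psi_base m l q \<phi> s (psi_base m l q \<phi> s)"
  unfolding psi_base_def using is_psi_base_ex1[OF assms] by (rule theI')

end

theory Submission
  imports Defs
begin

text \<open>
  Why the theorem is true: every \<open>s \<mapsto> \<psi>\<^sub>s(a)\<close> is not merely convex but logarithmically convex, and
  logarithmic convexity, unlike convexity, survives taking roots and products as well as sums
  (for sums this is Hoelder's inequality).

  On \<open>S\<^sup>l\<^sup>-\<^sup>1\<close> the function \<open>\<psi>\<^sub>s\<close> is only known through its equation, so no formula is available to
  which these closure properties apply. Instead, interpolate geometrically: for \<open>r = u s + v t\<close> with
  \<open>u + v = 1\<close>, put \<open>h = \<psi>\<^sub>s\<^sup>u \<psi>\<^sub>t\<^sup>v\<close>. The weights \<open>e\<^sup>s\<^sup>\<phi>\<close> depend log-linearly on \<open>s\<close>, so Hoelder's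
  inequality shows that \<open>h\<close> is a supersolution of the equation for \<open>\<psi>\<^sub>r\<close>: the right-hand side at \<open>h\<close>
  is at most \<open>h\<^sup>q\<close>. Since \<open>q > 1\<close>, a comparison principle places the solution below every positive
  supersolution, which gives \<open>\<psi>\<^sub>r \<le> \<psi>\<^sub>s\<^sup>u \<psi>\<^sub>t\<^sup>v\<close>.

  The extension to shorter words uses sums and roots only, so it stays log-convex. The pressure
  is a nonnegative multiple of the logarithm of a sum of log-convex functions.
\<close>

definition log_convex :: "(real \<Rightarrow> real) \<Rightarrow> bool" where
  "log_convex f \<longleftrightarrow> (\<forall>s. f s > 0) \<and> convex_on UNIV (\<lambda>s. ln (f s))"

text \<open>The multiplicative form of log-convexity is the one in which Hoelder's inequality and the
  supersolution argument speak.\<close>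

lemma log_convex_iff_powr:
  "log_convex f \<longleftrightarrow> (\<forall>s. f s > 0) \<and>
     (\<forall>x y u v. u \<ge> 0 \<longrightarrow> v \<ge> 0 \<longrightarrow> u + v = 1 \<longrightarrow> f (u * x + v * y) \<le> f x powr u * f y powr v)"
proof -
  have "ln (f (u * x + v * y)) \<le> u * ln (f x) + v * ln (f y) \<longleftrightarrow>
      f (u * x + v * y) \<le> f x powr u * f y powr v" if pos: "\<forall>s. f s > 0" for u v x y
  proof -
    have nz: "f s \<noteq> 0" for s using pos by (metis less_irrefl)
    then have "u * ln (f x) + v * ln (f y) = ln (f x powr u * f y powr v)"
      by (simp add: ln_mult)
    then show ?thesis using pos nz by simp
  qed
  then show ?thesis
    unfolding log_convex_def convex_on_def by auto
qed

lemma log_convex_imp_convex: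
  assumes "log_convex f"
  shows "convex_on UNIV f"
  unfolding convex_on_def
proof (intro conjI ballI allI impI)
  fix x y u v :: real
  assume uv: "u \<ge> 0" "v \<ge> 0" "u + v = 1"
  have "f (u * x + v * y) \<le> f x powr u * f y powr v"
    using assms uv by (auto simp: log_convex_iff_powr)
  also have "\<dots> \<le> u * f x + v * f y"
    using assms uv by (intro Youngs_inequality_0) (auto simp: log_convex_def)
  finally show "f (u *\<^sub>R x + v *\<^sub>R y) \<le> u * f x + v * f y" by simp
qed simp

text \<open>Hoelder's inequality with conjugate exponents \<open>1/u\<close> and \<open>1/v\<close>, which follows from Young's
  inequality once both families are normalised to have sum one.\<close>

lemma sum_powr_mult_powr_le:
  fixes x y :: "'a \<Rightarrow> real"
  assumes fin: "finite J" and ne: "J \<noteq> {}"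
    and x: "\<And>j. j \<in> J \<Longrightarrow> x j > 0" and y: "\<And>j. j \<in> J \<Longrightarrow> y j > 0"
    and uv: "u \<ge> 0" "v \<ge> 0" "u + v = 1"
  shows "(\<Sum>j\<in>J. x j powr u * y j powr v) \<le> (\<Sum>j\<in>J. x j) powr u * (\<Sum>j\<in>J. y j) powr v"
proof -
  define X Y where "X = (\<Sum>j\<in>J. x j)" and "Y = (\<Sum>j\<in>J. y j)"
  have X: "X > 0" and Y: "Y > 0"
    unfolding X_def Y_def using assms by (auto intro: sum_pos)
  have "x j powr u * y j powr v \<le> X powr u * Y powr v * (u * (x j / X) + v * (y j / Y))"
    if j: "j \<in> J" for j
  proof -
    have "(x j / X) powr u * (y j / Y) powr v \<le> u * (x j / X) + v * (y j / Y)"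
      using x[OF j] y[OF j] X Y uv by (intro Youngs_inequality_0) auto
    then have "X powr u * Y powr v * ((x j / X) powr u * (y j / Y) powr v)
        \<le> X powr u * Y powr v * (u * (x j / X) + v * (y j / Y))"
      by (intro mult_left_mono) auto
    moreover have "X powr u * Y powr v * ((x j / X) powr u * (y j / Y) powr v)
        = x j powr u * y j powr v"
      using x[OF j] y[OF j] X Y by (simp add: powr_divide)
    ultimately show ?thesis by simp
  qed
  then have "(\<Sum>j\<in>J. x j powr u * y j powr v)
      \<le> (\<Sum>j\<in>J. X powr u * Y powr v * (u * (x j / X) + v * (y j / Y)))"
    by (rule sum_mono)
  also have "\<dots> = X powr u * Y powr v * (u * (X / X) + v * (Y / Y))"
    by (simp add: X_def Y_def sum.distrib flip: sum_distrib_left sum_divide_distrib)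
  also have "\<dots> = X powr u * Y powr v" using X Y uv by simp
  finally show ?thesis by (simp add: X_def Y_def)
qed

lemma log_convex_sum:
  assumes fin: "finite J" and ne: "J \<noteq> {}" and f: "\<And>j. j \<in> J \<Longrightarrow> log_convex (f j)"
  shows "log_convex (\<lambda>s. \<Sum>j\<in>J. f j s)"
  unfolding log_convex_iff_powr
proof (intro conjI allI impI)
  fix s
  show "(\<Sum>j\<in>J. f j s) > 0"
    using fin ne f by (intro sum_pos) (auto simp: log_convex_def)
next
  fix x y u v :: real
  assume uv: "u \<ge> 0" "v \<ge> 0" "u + v = 1"
  have "(\<Sum>j\<in>J. f j (u * x + v * y)) \<le> (\<Sum>j\<in>J. f j x powr u * f j y powr v)"
    using f uv by (intro sum_mono) (auto simp: log_convex_iff_powr)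
  also have "\<dots> \<le> (\<Sum>j\<in>J. f j x) powr u * (\<Sum>j\<in>J. f j y) powr v"
    using fin ne f uv by (intro sum_powr_mult_powr_le) (auto simp: log_convex_def)
  finally show "(\<Sum>j\<in>J. f j (u * x + v * y)) \<le> (\<Sum>j\<in>J. f j x) powr u * (\<Sum>j\<in>J. f j y) powr v" .
qed

lemma log_convex_root:
  assumes "n > 0" "log_convex f"
  shows "log_convex (\<lambda>s. root n (f s))"
proof -
  have "convex_on UNIV (\<lambda>s. (1 / real n) * ln (f s))"
    using assms by (intro convex_on_cmul) (auto simp: log_convex_def)
  then show ?thesis
    using assms by (simp add: log_convex_def ln_root)
qed

text \<open>The comparison principle. At a word where the ratio \<open>R\<close> of the solution to the supersolution
  is maximal, bounding the solution by \<open>R\<close> times the supersolution in the linear right-hand side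
  costs a factor \<open>R\<close>, while the left-hand side equals \<open>R\<^sup>q\<close> times that of the supersolution; hence \<open>R\<^sup>q \<le> R\<close>, which forces \<open>R \<le> 1\<close> because \<open>q > 1\<close>.\<close>

lemma is_psi_base_le_supersolution:
  assumes f: "is_psi_base m l q \<phi> s f"
    and h_pos: "\<And>b. b \<in> words m (l - 1) \<Longrightarrow> h b > 0"
    and h_super: "\<And>b. b \<in> words m (l - 1) \<Longrightarrow>
      (\<Sum>j<m. exp (s * \<phi> (b @ [j])) * h (tl b @ [j])) \<le> h b ^ q"
    and l: "l \<ge> 2" and q: "q \<ge> 2" and a: "a \<in> words m (l - 1)"
  shows "f a \<le> h a"
proof -
  let ?W = "words m (l - 1)"
  define R where "R = Max ((\<lambda>b. f b / h b) ` ?W)"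
  have fin: "finite ((\<lambda>b. f b / h b) ` ?W)" using finite_words by simp
  have R: "f b \<le> R * h b" if "b \<in> ?W" for b
  proof -
    have "f b / h b \<le> R" unfolding R_def using fin that by (intro Max_ge) auto
    then show ?thesis using h_pos[OF that] by (simp add: field_simps)
  qed
  have "R \<in> (\<lambda>b. f b / h b) ` ?W" unfolding R_def using fin a by (intro Max_in) auto
  then obtain b where b: "b \<in> ?W" "R = f b / h b" by auto
  have "f b > 0" using f b(1) by (auto simp: is_psi_base_def PiE_def Pi_def)
  then have R_pos: "R > 0" using b h_pos by simp
  have "(R * h b) ^ q = f b ^ q" using b h_pos[OF b(1)] by simp
  also have "\<dots> = (\<Sum>j<m. exp (s * \<phi> (b @ [j])) * f (tl b @ [j]))"
    using f b by (simp add: is_psi_base_def)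
  also have "\<dots> \<le> (\<Sum>j<m. exp (s * \<phi> (b @ [j])) * (R * h (tl b @ [j])))"
    using R words_shift[OF b(1) _ l] by (intro sum_mono mult_left_mono) auto
  also have "\<dots> = R * (\<Sum>j<m. exp (s * \<phi> (b @ [j])) * h (tl b @ [j]))"
    by (simp add: sum_distrib_left mult_ac)
  also have "\<dots> \<le> R * h b ^ q"
    using h_super[OF b(1)] R_pos by (intro mult_left_mono) auto
  finally have "R ^ q \<le> R" using h_pos[OF b(1)] by (simp add: power_mult_distrib)
  then have "R \<le> 1"
    using power_strict_increasing[of 1 q R] q by force
  then have "R * h a \<le> 1 * h a" using h_pos[OF a] by (intro mult_right_mono) auto
  then show ?thesis using R[OF a] by simp
qed

text \<open>The geometric mean of the solutions at \<open>x\<close> and \<open>y\<close> is a supersolution at \<open>u x + v y\<close>: each of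
  its summands is the geometric mean of the summands at \<open>x\<close> and \<open>y\<close>, so Hoelder's inequality
  applies, and the power \<open>q\<close> commutes with geometric means.\<close>

lemma log_convex_psi_base:
  assumes m: "m \<ge> 2" and l: "l \<ge> 2" and q: "q \<ge> 2" and a: "a \<in> words m (l - 1)"
  shows "log_convex (\<lambda>s. psi_base m l q \<phi> s a)"
proof -
  let ?W = "words m (l - 1)" and ?f = "psi_base m l q \<phi>"
  have sol: "is_psi_base m l q \<phi> s (?f s)" for s
    using m l q by (rule is_psi_base_psi_base)
  have pos: "?f s b > 0" if "b \<in> ?W" for s b
    using sol[of s] that by (auto simp: is_psi_base_def PiE_def Pi_def)
  have eq: "(\<Sum>j<m. exp (s * \<phi> (b @ [j])) * ?f s (tl b @ [j])) = ?f s b ^ q"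
    if "b \<in> ?W" for s b
    using sol[of s] that by (auto simp: is_psi_base_def)
  have pow_powr: "(z ^ q) powr w = (z powr w) ^ q" if "z > 0" for z w :: real
    using that by (simp add: powr_powr mult.commute less_imp_neq[symmetric] flip: powr_realpow)
  have "?f (u * x + v * y) a \<le> ?f x a powr u * ?f y a powr v"
    if uv: "u \<ge> 0" "v \<ge> 0" "u + v = 1" for x y u v
  proof (rule is_psi_base_le_supersolution[OF sol _ _ l q a])
    fix b assume b: "b \<in> ?W"
    show "?f x b powr u * ?f y b powr v > 0" using pos[OF b] by (simp add: less_imp_neq[symmetric])
    let ?t = "\<lambda>s j. exp (s * \<phi> (b @ [j])) * ?f s (tl b @ [j])"
    have "(\<Sum>j<m. exp ((u * x + v * y) * \<phi> (b @ [j])) *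
            (?f x (tl b @ [j]) powr u * ?f y (tl b @ [j]) powr v))
        = (\<Sum>j<m. ?t x j powr u * ?t y j powr v)"
      by (intro sum.cong refl)
        (simp add: powr_mult exp_powr_real algebra_simps exp_add)
    also have "\<dots> \<le> (\<Sum>j<m. ?t x j) powr u * (\<Sum>j<m. ?t y j) powr v"
      using m uv pos words_shift[OF b _ l]
      by (intro sum_powr_mult_powr_le) (auto simp: lessThan_empty_iff)
    also have "\<dots> = (?f x b ^ q) powr u * (?f y b ^ q) powr v"
      by (simp add: eq[OF b])
    also have "\<dots> = (?f x b powr u * ?f y b powr v) ^ q"
      using pos[OF b] by (simp add: power_mult_distrib pow_powr)
    finally show "(\<Sum>j<m. exp ((u * x + v * y) * \<phi> (b @ [j])) *
            (?f x (tl b @ [j]) powr u * ?f y (tl b @ [j]) powr v))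
        \<le> (?f x b powr u * ?f y b powr v) ^ q" .
  qed
  then show ?thesis using pos[OF a] by (simp add: log_convex_iff_powr)
qed

lemma log_convex_psi:
  assumes m: "m \<ge> 2" and l: "l \<ge> 2" and q: "q \<ge> 2" and "a \<in> words m k" and "k \<le> l - 1"
  shows "log_convex (\<lambda>s. psi m l q \<phi> s a)"
  using assms(5,4)
proof (induction k arbitrary: a rule: inc_induct)
  case base
  then show ?case
    using log_convex_psi_base[OF m l q base] by (simp add: psi.simps words_def)
next
  case (step k)
  have "log_convex (\<lambda>s. psi m l q \<phi> s (a @ [j]))" if "j < m" for j
    using that step.prems by (intro step.IH) (auto simp: words_def)
  then have "log_convex (\<lambda>s. root q (\<Sum>j<m. psi m l q \<phi> s (a @ [j])))"
    using m q by (intro log_convex_root log_convex_sum) (auto simp: lessThan_empty_iff)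
  moreover have "psi m l q \<phi> s a = root q (\<Sum>j<m. psi m l q \<phi> s (a @ [j]))" for s
    using step by (subst psi.simps) (simp add: words_def)
  ultimately show ?case by simp
qed

theorem theorem4p7:
  fixes m l q :: nat and \<phi> :: "nat list \<Rightarrow> real"
  assumes "m \<ge> 2" and "l \<ge> 2" and "q \<ge> 2"
  shows "(\<forall>a \<in> (\<Union>j\<in>{1..l}. words m (l - j)). convex_on UNIV (\<lambda>s. psi m l q \<phi> s a)) \<and>
         convex_on UNIV (\<lambda>s. pressure m l q \<phi> s)"
proof (intro conjI ballI)
  fix a assume "a \<in> (\<Union>j\<in>{1..l}. words m (l - j))"
  then obtain j where "j \<ge> 1" "a \<in> words m (l - j)" by auto
  then show "convex_on UNIV (\<lambda>s. psi m l q \<phi> s a)"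
    using assms by (intro log_convex_imp_convex log_convex_psi) auto
next
  have "log_convex (\<lambda>s. \<Sum>j<m. psi m l q \<phi> s [j])"
    using assms by (intro log_convex_sum log_convex_psi[where k = 1])
      (auto simp: lessThan_empty_iff words_def)
  then show "convex_on UNIV (\<lambda>s. pressure m l q \<phi> s)"
    unfolding pressure_def using assms
    by (intro convex_on_cmul) (auto simp: log_convex_def)
qed

end
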